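(* Let $c<1$ be a constant. For each $n$ let $\mathbf{p}^{(n)}=(p_1,\dots,p_m)$, $m=m(n)$, be a vector of probabilities with $n\sum_{i=1}^m p_i^2 = c$, and let $G$ be the inhomogeneous random intersection graph with parameters $n$ and $\mathbf{p}^{(n)}$. Let $p=\max_i p_i$. Then with high probability every connected component of $G$ has $O(\max\{np\log n,\ \log n\})$ vertices.
   Context: Inhomogeneous random intersection graph: given $n$ vertices $V$, attributes $A=\{a_1,\dots,a_m\}$ and probabilities $\mathbf{p}=(p_i)_{i=1}^m$, let $\mathcal{I}_{v,a_i}$, $(v,a_i)\in V\times A$, be independent Bernoulli$(p_i)$ random variables. The random bipartite graph $B$ on $V\cup A$ has edge $(v,a_i)$ iff $\mathcal{I}_{v,a_i}=1$; the random intersection graph $G$ on $V$ joins two distinct vertices iff they share at least one common attribute in $B$. Results are asymptotic as $n\to\infty$ for a sequence of parameter vectors $\mathbf{p}^{(n)}$; an event holds with high probability if its probability tends to $1$ as $n\to\infty$. *)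

theory Defs
  imports "HOL-Probability.Probability" "HOL-Probability.Product_PMF"
begin

text \<open>
  Vertices are \<open>{1..n}\<close>, attributes are \<open>{1..m}\<close>. A family of indicators \<open>I\<close> yields the
  bipartite graph whose edge set is the set of pairs \<open>(v, i)\<close> with \<open>I (v, i)\<close>.
\<close>

definition attribute_indicators ::
    "nat \<Rightarrow> nat \<Rightarrow> (nat \<Rightarrow> real) \<Rightarrow> (nat \<times> nat \<Rightarrow> bool) pmf" where
  "attribute_indicators n m p =
     Pi_pmf ({1..n} \<times> {1..m}) False (\<lambda>(v, i). bernoulli_pmf (p i))"

definition bipartite_edges ::
    "nat \<Rightarrow> nat \<Rightarrow> (nat \<times> nat \<Rightarrow> bool) \<Rightarrow> (nat \<times> nat) set" where
  "bipartite_edges n m I = {(v, i). v \<in> {1..n} \<and> i \<in> {1..m} \<and> I (v, i)}"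

text \<open>The edges of an undirected graph are represented by a symmetric, irreflexive relation.\<close>

definition intersection_edges :: "'v set \<Rightarrow> ('v \<times> 'a) set \<Rightarrow> ('v \<times> 'v) set" where
  "intersection_edges V B =
     {(u, v). u \<in> V \<and> v \<in> V \<and> u \<noteq> v \<and> (\<exists>a. (u, a) \<in> B \<and> (v, a) \<in> B)}"

definition random_intersection_graph ::
    "nat \<Rightarrow> nat \<Rightarrow> (nat \<Rightarrow> real) \<Rightarrow> (nat \<times> nat) set pmf" where
  "random_intersection_graph n m p =
     map_pmf (\<lambda>I. intersection_edges {1..n} (bipartite_edges n m I))
       (attribute_indicators n m p)"

definition connected_components :: "'v set \<Rightarrow> ('v \<times> 'v) set \<Rightarrow> 'v set set" where
  "connected_components V E = V // {(u, v). u \<in> V \<and> v \<in> V \<and> (u, v) \<in> E\<^sup>*}"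

end

theory Submission
  imports Defs
begin

text \<open>
  The component of a vertex is explored in the bipartite graph, one vertex or attribute at a time.
  Give every vertex the weight \<open>exp \<kappa>\<close> and every attribute the weight \<open>1\<close>, and bound the expected
  product of the weights of the explored nodes by a product of potentials \<open>h\<close> over the active nodes:
  \<open>1 + \<epsilon>\<close> for a vertex and \<open>(1 + \<epsilon> p\<^sub>i)\<^sup>n\<close> for the attribute \<open>i\<close>. Exploring a node preserves the bound if
  \<open>exp \<kappa> * \<Prod>\<^sub>i (1 + p\<^sub>i ((1 + \<epsilon> p\<^sub>i)\<^sup>n - 1)) \<le> 1 + \<epsilon>\<close>. For \<open>\<epsilon>\<close> a small multiple of \<open>1 / max (n p) 1\<close>
  the product is about \<open>exp (\<epsilon> c)\<close>, so that, as \<open>c < 1\<close>, \<open>\<kappa>\<close> may be taken proportional to \<open>\<epsilon>\<close>.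
  Markov's inequality and a union bound over the vertices conclude.
\<close>

section \<open>Product distributions\<close>

text \<open>If the first argument of \<open>F\<close> is read only on \<open>R\<close> and the
  second only off \<open>R\<close>, the two arguments depend on disjoint blocks of independent
  coordinates, so the second may be replaced by an independent copy. In the exploration,
  \<open>R\<close> holds the indicators revealed now and the copy stands for those still
  hidden.\<close>

lemma nn_integral_Pi_pmf_decouple:
  fixes F :: "('j \<Rightarrow> 'b) \<Rightarrow> ('j \<Rightarrow> 'b) \<Rightarrow> ennreal"
  assumes "finite D"
    and left: "\<And>f f' g. (\<And>x. x \<in> R \<Longrightarrow> f x = f' x) \<Longrightarrow> F f g = F f' g"
    and right: "\<And>f g g'. (\<And>x. x \<notin> R \<Longrightarrow> g x = g' x) \<Longrightarrow> F f g = F f g'"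
  shows "(\<integral>\<^sup>+f. F f f \<partial>Pi_pmf D d P) = (\<integral>\<^sup>+f. \<integral>\<^sup>+g. F f g \<partial>Pi_pmf D d P \<partial>Pi_pmf D d P)"
proof -
  define merge where "merge = (\<lambda>f g x. if x \<in> D \<inter> R then f x else (g x :: 'b))"
  define A where "A = Pi_pmf (D \<inter> R) d P"
  define B where "B = Pi_pmf (D - R) d P"
  have "D = D \<inter> R \<union> (D - R)" by blast
  then have "Pi_pmf D d P = Pi_pmf (D \<inter> R \<union> (D - R)) d P" by simp
  also have "\<dots> = map_pmf (\<lambda>(f, g). merge f g) (pair_pmf A B)"
    using \<open>finite D\<close> unfolding A_def B_def merge_def by (subst Pi_pmf_union) auto
  finally have split: "Pi_pmf D d P = map_pmf (\<lambda>(f, g). merge f g) (pair_pmf A B)" .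
  \<comment> \<open>Off \<open>D\<close> every sample has the default value \<open>d\<close>, so
    \<open>merge f g\<close> agrees with \<open>f\<close> on all of \<open>R\<close>, not only on
    \<open>D \<inter> R\<close>.\<close>
  have outA: "f x = d" if "f \<in> set_pmf A" "x \<notin> D" for f x
    using that set_Pi_pmf_subset[of "D \<inter> R" d P] \<open>finite D\<close> by (auto simp: A_def)
  have outB: "g x = d" if "g \<in> set_pmf B" "x \<notin> D" for g x
    using that set_Pi_pmf_subset[of "D - R" d P] \<open>finite D\<close> by (auto simp: B_def)
  have mm: "F (merge f g) (merge f' g') = F f g'"
    if "f \<in> set_pmf A" "g \<in> set_pmf B" "f' \<in> set_pmf A" "g' \<in> set_pmf B" for f g f' g'
  proof -
    have "F (merge f g) (merge f' g') = F f (merge f' g')"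
      using that by (intro left) (auto simp: merge_def outA outB)
    also have "\<dots> = F f g'"
      by (intro right) (auto simp: merge_def)
    finally show ?thesis .
  qed
  have "(\<integral>\<^sup>+f. F f f \<partial>Pi_pmf D d P) = (\<integral>\<^sup>+f. \<integral>\<^sup>+g. F (merge f g) (merge f g) \<partial>B \<partial>A)"
    unfolding split by (simp add: nn_integral_pair_pmf')
  also have "\<dots> = (\<integral>\<^sup>+f. \<integral>\<^sup>+g. F f g \<partial>B \<partial>A)"
    by (intro nn_integral_cong_AE AE_pmfI) (simp add: mm)
  \<comment> \<open>Two dummy integrations of total mass 1 are inserted, over \<open>g\<close> and
    \<open>f'\<close>, so that the pairs \<open>(f, g)\<close> and \<open>(f', g')\<close> become
    two full independent samples.\<close>
  also have "\<dots> = (\<integral>\<^sup>+f. \<integral>\<^sup>+g. \<integral>\<^sup>+f'. \<integral>\<^sup>+g'. F (merge f g) (merge f' g') \<partial>B \<partial>A \<partial>B \<partial>A)"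
  proof (rule nn_integral_cong_AE[OF AE_pmfI])
    fix f assume f: "f \<in> set_pmf A"
    have "(\<integral>\<^sup>+g. \<integral>\<^sup>+f'. \<integral>\<^sup>+g'. F (merge f g) (merge f' g') \<partial>B \<partial>A \<partial>B)
       = (\<integral>\<^sup>+g. \<integral>\<^sup>+f'. \<integral>\<^sup>+g'. F f g' \<partial>B \<partial>A \<partial>B)"
      using f by (intro nn_integral_cong_AE AE_pmfI) (simp add: mm)
    then show "(\<integral>\<^sup>+g. F f g \<partial>B) = (\<integral>\<^sup>+g. \<integral>\<^sup>+f'. \<integral>\<^sup>+g'. F (merge f g) (merge f' g') \<partial>B \<partial>A \<partial>B)"
      by simp
  qed
  also have "\<dots> = (\<integral>\<^sup>+f. \<integral>\<^sup>+g. F f g \<partial>Pi_pmf D d P \<partial>Pi_pmf D d P)"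
    unfolding split by (simp add: nn_integral_pair_pmf')
  finally show ?thesis .
qed

lemma nn_integral_prod_Pi_pmf_inj:
  fixes \<phi> :: "'y \<Rightarrow> 'b \<Rightarrow> ennreal"
  assumes "finite D" "inj_on k N" "k ` N \<subseteq> D"
  shows "(\<integral>\<^sup>+f. (\<Prod>y\<in>N. \<phi> y (f (k y))) \<partial>Pi_pmf D d P) = (\<Prod>y\<in>N. \<integral>\<^sup>+b. \<phi> y b \<partial>P (k y))"
proof -
  define \<psi> where "\<psi> j = (if j \<in> k ` N then \<phi> (the_inv_into N k j) else (\<lambda>_. 1))" for j
  have \<psi>: "\<psi> (k y) = \<phi> y" if "y \<in> N" for y
    using that assms(2) by (auto simp: \<psi>_def the_inv_into_f_f)
  have "(\<Prod>y\<in>N. \<phi> y (f (k y))) = (\<Prod>j\<in>D. \<psi> j (f j))" for f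
  proof -
    have "(\<Prod>j\<in>D. \<psi> j (f j)) = (\<Prod>j\<in>k ` N. \<psi> j (f j))"
      using assms by (intro prod.mono_neutral_right) (auto simp: \<psi>_def)
    also have "\<dots> = (\<Prod>y\<in>N. \<phi> y (f (k y)))"
      using assms(2) by (simp add: prod.reindex \<psi>)
    finally show ?thesis by simp
  qed
  then have "(\<integral>\<^sup>+f. (\<Prod>y\<in>N. \<phi> y (f (k y))) \<partial>Pi_pmf D d P) = (\<Prod>j\<in>D. \<integral>\<^sup>+b. \<psi> j b \<partial>P j)"
    using assms(1) by (simp add: nn_integral_prod_Pi_pmf)
  also have "\<dots> = (\<Prod>j\<in>k ` N. \<integral>\<^sup>+b. \<psi> j b \<partial>P j)"
    using assms by (intro prod.mono_neutral_right) (auto simp: \<psi>_def)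
  also have "\<dots> = (\<Prod>y\<in>N. \<integral>\<^sup>+b. \<phi> y b \<partial>P (k y))"
    using assms(2) by (simp add: prod.reindex \<psi>)
  finally show ?thesis .
qed

section \<open>Exploration of a random graph with independent edges\<close>

text \<open>\<open>S\<close> is the set of active nodes and \<open>U\<close> that of nodes not yet
  discovered. Only the target of a step is restricted, so walks may start in \<open>S\<close> but
  can move only into \<open>U\<close>.\<close>

definition reach :: "('x \<times> 'x) set \<Rightarrow> 'x set \<Rightarrow> 'x set \<Rightarrow> 'x set" where
  "reach E S U = (E \<inter> UNIV \<times> U)\<^sup>* `` S"

lemma reach_subset: "reach E S U \<subseteq> S \<union> U"
proof
  fix y assume "y \<in> reach E S U"
  then obtain x where "x \<in> S" "(x, y) \<in> (E \<inter> UNIV \<times> U)\<^sup>*" by (auto simp: reach_def)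
  from this(2,1) show "y \<in> S \<union> U" by (induction rule: rtrancl_induct) auto
qed

text \<open>A restricted walk never leaves \<open>S \<union> U\<close>, so edges with another
  source, or with a target outside \<open>U\<close>, cannot matter.\<close>

lemma reach_mono_edges:
  assumes "E \<inter> (S \<union> U) \<times> U \<subseteq> E'"
  shows "reach E S U \<subseteq> reach E' S U"
proof
  fix y assume "y \<in> reach E S U"
  then obtain x where x: "x \<in> S" and "(x, y) \<in> (E \<inter> UNIV \<times> U)\<^sup>*" by (auto simp: reach_def)
  from this(2) show "y \<in> reach E' S U"
  proof (induction rule: rtrancl_induct)
    case base
    then show ?case using x by (auto simp: reach_def)
  next
    case (step y z)
    with reach_subset[of E' S U] assms have "(y, z) \<in> E' \<inter> UNIV \<times> U" by auto
    with step.IH show ?case by (auto simp: reach_def intro: rtrancl.rtrancl_into_rtrancl)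
  qed
qed

lemma reach_cong:
  assumes "E \<inter> (S \<union> U) \<times> U = E' \<inter> (S \<union> U) \<times> U"
  shows "reach E S U = reach E' S U"
  using assms by (intro equalityI reach_mono_edges) blast+

text \<open>One exploration step: \<open>s\<close> is finished and its undiscovered neighbours
  \<open>T\<close> become active. A walk entering \<open>T\<close> can be restarted there; any other
  step cannot leave from \<open>s\<close>, hence it is also a step of the smaller
  exploration.\<close>

lemma reach_explore:
  assumes "T = E `` {s} \<inter> U"
  shows "reach E S U \<subseteq> insert s (reach E (S - {s} \<union> T) (U - T))"
proof
  fix y assume "y \<in> reach E S U"
  then obtain x where x: "x \<in> S" and "(x, y) \<in> (E \<inter> UNIV \<times> U)\<^sup>*" by (auto simp: reach_def)
  from this(2) show "y \<in> insert s (reach E (S - {s} \<union> T) (U - T))"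
  proof (induction rule: rtrancl_induct)
    case base
    then show ?case using x by (auto simp: reach_def)
  next
    case (step y z)
    show ?case
    proof (cases "z \<in> T")
      case True
      then show ?thesis by (auto simp: reach_def)
    next
      case False
      with step assms have "y \<noteq> s" "(y, z) \<in> E \<inter> UNIV \<times> (U - T)" by auto
      with step.IH show ?thesis by (auto simp: reach_def intro: rtrancl.rtrancl_into_rtrancl)
    qed
  qed
qed

text \<open>A walk that returns to \<open>x\<close> can be restarted at \<open>x\<close>, so
  \<open>x\<close> may be removed from the allowed targets.\<close>

lemma rtrancl_subset_reach:
  assumes "Range E \<subseteq> V"
  shows "E\<^sup>* `` {x} \<subseteq> reach E {x} (V - {x})"
proof
  fix y assume "y \<in> E\<^sup>* `` {x}"
  then have "(x, y) \<in> E\<^sup>*" by simp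
  then show "y \<in> reach E {x} (V - {x})"
  proof (induction rule: rtrancl_induct)
    case base
    then show ?case by (auto simp: reach_def)
  next
    case (step y z)
    with assms have "z \<in> V" by blast
    with step show ?case
      by (cases "z = x") (auto simp: reach_def intro: rtrancl.rtrancl_into_rtrancl)
  qed
qed

section \<open>The expected weight of the explored set\<close>

text \<open>Induction on the number of active and undiscovered nodes. Exploring an active
  \<open>s\<close> pays \<open>w s\<close> and trades \<open>h s\<close> for the potentials of the
  neighbours found; independence turns their expected product into the product in
  \<open>drift\<close>, which \<open>h s\<close> covers. By \<open>inj\<close> only the two
  directions of one edge can share an indicator, so the indicators at \<open>s\<close> never
  reappear.\<close>

lemma exploration_weight_bound:
  fixes L :: "('x \<times> 'x) set" and e :: "'x \<Rightarrow> 'x \<Rightarrow> 'j" and q :: "'j \<Rightarrow> real" and h w :: "'x \<Rightarrow> real"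
  defines "G \<equiv> \<lambda>I. {(x, y) \<in> L. I (e x y)}"
  assumes fin: "finite D" "finite L"
    and eD: "\<And>x y. (x, y) \<in> L \<Longrightarrow> e x y \<in> D"
    and inj: "\<And>x y x' y'. (x, y) \<in> L \<Longrightarrow> (x', y') \<in> L \<Longrightarrow> e x y = e x' y' \<Longrightarrow> {x, y} = {x', y'}"
    and q: "\<And>j. j \<in> D \<Longrightarrow> 0 \<le> q j \<and> q j \<le> 1"
    and h: "\<And>x. 1 \<le> h x" and w: "\<And>x. 1 \<le> w x"
    and drift: "\<And>x. w x * (\<Prod>y\<in>L `` {x}. 1 + q (e x y) * (h y - 1)) \<le> h x"
    and SU: "finite S" "finite U" "S \<inter> U = {}"
  shows "(\<integral>\<^sup>+I. ennreal (\<Prod>y\<in>reach (G I) S U. w y) \<partial>Pi_pmf D False (\<lambda>j. bernoulli_pmf (q j)))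
     \<le> ennreal (\<Prod>x\<in>S. h x)"
  using SU
proof (induction "card S + card U" arbitrary: S U rule: less_induct)
  case less
  let ?P = "Pi_pmf D False (\<lambda>j. bernoulli_pmf (q j))"
  show ?case
  proof (cases "S = {}")
    case True
    then show ?thesis by (simp add: reach_def)
  next
    case False
    then obtain s where s: "s \<in> S" by blast
    with less.prems have sU: "s \<notin> U" by blast
    define T where "T I = G I `` {s} \<inter> U" for I
    define N where "N = L `` {s} \<inter> U"
    have T_alt: "T I = {y \<in> N. I (e s y)}" for I
      by (auto simp: T_def N_def G_def)
    have finN: "finite N" using less.prems by (simp add: N_def)
    have finT: "finite (T I)" for I using finN by (simp add: T_alt)
    have TU: "T I \<subseteq> U" for I by (auto simp: T_def)
    \<comment> \<open>The two uses of the randomness are separated: \<open>f\<close> decides which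
      neighbours of \<open>s\<close> are found, \<open>g\<close> drives the rest of the
      exploration.\<close>
    define F where "F f g = ennreal (\<Prod>y\<in>reach (G g) (S - {s} \<union> T f) (U - T f). w y)" for f g
    define R where "R = e s ` (L `` {s})"
    have finreach: "finite (reach E A B)" if "finite A" "finite B" for E A B
      using that reach_subset[of E A B] finite_subset by blast
    have pos: "0 \<le> prod w A" "0 \<le> prod h A" for A
      using h w by (auto intro!: prod_nonneg intro: order.trans[OF zero_le_one])

    have step: "ennreal (\<Prod>y\<in>reach (G I) S U. w y) \<le> ennreal (w s) * F I I" for I
    proof -
      let ?R = "reach (G I) (S - {s} \<union> T I) (U - T I)"
      have "?R \<subseteq> (S - {s} \<union> T I) \<union> (U - T I)" by (rule reach_subset)
      with sU TU have "s \<notin> ?R" by blast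
      have finR: "finite ?R" using less.prems finT by (intro finreach) auto
      have "(\<Prod>y\<in>reach (G I) S U. w y) \<le> (\<Prod>y\<in>insert s ?R. w y)"
        using finR w reach_explore[OF T_def]
        by (intro prod_mono2) (auto intro: order.trans[OF zero_le_one])
      also have "\<dots> = w s * (\<Prod>y\<in>?R. w y)"
        using \<open>s \<notin> ?R\<close> finR by simp
      finally show ?thesis
        using w[of s] pos by (simp add: F_def flip: ennreal_mult)
    qed
    have "(\<integral>\<^sup>+I. F I I \<partial>?P) = (\<integral>\<^sup>+f. \<integral>\<^sup>+g. F f g \<partial>?P \<partial>?P)"
    proof (rule nn_integral_Pi_pmf_decouple[where R = R])
      show "finite D" by fact
      show "F f g = F f' g" if "\<And>x. x \<in> R \<Longrightarrow> f x = f' x" for f f' g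
      proof -
        have "T f = T f'" using that by (auto simp: T_alt N_def R_def)
        then show ?thesis by (simp add: F_def)
      qed
      show "F f g = F f g'" if eq: "\<And>x. x \<notin> R \<Longrightarrow> g x = g' x" for f g g'
      proof -
        have "reach (G g) (S - {s} \<union> T f) (U - T f) = reach (G g') (S - {s} \<union> T f) (U - T f)"
        proof (rule reach_cong)
          \<comment> \<open>After \<open>s\<close> is explored it is neither active nor
            undiscovered, and by \<open>inj\<close> an edge avoiding \<open>s\<close> has its
            indicator outside \<open>R\<close>.\<close>
          have "g (e x y) = g' (e x y)" if "(x, y) \<in> L" "x \<noteq> s" "y \<noteq> s" for x y
          proof (rule eq)
            show "e x y \<notin> R"
            proof
              assume "e x y \<in> R"
              then obtain z where "(s, z) \<in> L" "e x y = e s z" by (auto simp: R_def)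
              with inj that(1) have "{x, y} = {s, z}" by metis
              with that show False by (auto simp: doubleton_eq_iff)
            qed
          qed
          moreover have "x \<noteq> s \<and> y \<noteq> s" if "x \<in> S - {s} \<union> T f \<union> (U - T f)" "y \<in> U - T f" for x y
            using that sU TU[of f] by auto
          ultimately have "(x, y) \<in> G g \<inter> (S - {s} \<union> T f \<union> (U - T f)) \<times> (U - T f)
            \<longleftrightarrow> (x, y) \<in> G g' \<inter> (S - {s} \<union> T f \<union> (U - T f)) \<times> (U - T f)" for x y
            unfolding G_def mem_Times_iff Int_iff mem_Collect_eq prod.case fst_conv snd_conv by meson
          then show "G g \<inter> (S - {s} \<union> T f \<union> (U - T f)) \<times> (U - T f)
            = G g' \<inter> (S - {s} \<union> T f \<union> (U - T f)) \<times> (U - T f)"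
            by (simp only: set_eq_iff split_paired_All) blast
        qed
        then show ?thesis by (simp add: F_def)
      qed
    qed
    also have "\<dots> \<le> (\<integral>\<^sup>+f. ennreal (\<Prod>x\<in>S - {s}. h x) * (\<Prod>y\<in>N. if f (e s y) then ennreal (h y) else 1) \<partial>?P)"
    proof (rule nn_integral_mono)
      fix f
      have "(\<integral>\<^sup>+g. F f g \<partial>?P) \<le> ennreal (\<Prod>x\<in>S - {s} \<union> T f. h x)"
        unfolding F_def
      proof (rule less.hyps)
        \<comment> \<open>Moving \<open>T f\<close> from undiscovered to active does not raise the
          total, and dropping \<open>s\<close> lowers it by one.\<close>
        have "card (S - {s} \<union> T f) + card (U - T f) \<le> card (S - {s}) + card (T f) + (card U - card (T f))"
          using card_Un_le[of "S - {s}" "T f"] TU[of f] less.prems finT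
          by (simp add: card_Diff_subset)
        moreover have "card (T f) \<le> card U" using TU less.prems by (simp add: card_mono)
        moreover have "card (S - {s}) < card S"
          using s less.prems by (intro psubset_card_mono) auto
        ultimately show "card (S - {s} \<union> T f) + card (U - T f) < card S + card U" by linarith
      qed (use less.prems finT TU in auto)
      also have "(\<Prod>x\<in>S - {s} \<union> T f. h x) = (\<Prod>x\<in>S - {s}. h x) * (\<Prod>x\<in>T f. h x)"
        using less.prems finT TU by (intro prod.union_disjoint) auto
      also have "ennreal \<dots> = ennreal (\<Prod>x\<in>S - {s}. h x) * ennreal (\<Prod>x\<in>T f. h x)"
        using pos by (simp add: ennreal_mult)
      also have "ennreal (\<Prod>x\<in>T f. h x) = (\<Prod>x\<in>T f. ennreal (h x))"
        using h by (subst prod_ennreal) (auto intro: order.trans[OF zero_le_one])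
      \<comment> \<open>A product over the random set \<open>T f\<close> becomes one over the fixed
        set \<open>N\<close>, with one indicator per factor.\<close>
      also have "\<dots> = (\<Prod>y\<in>N. if f (e s y) then ennreal (h y) else 1)"
        unfolding T_alt using finN by (rule prod.inter_filter)
      finally show "(\<integral>\<^sup>+g. F f g \<partial>?P)
        \<le> ennreal (\<Prod>x\<in>S - {s}. h x) * (\<Prod>y\<in>N. if f (e s y) then ennreal (h y) else 1)" .
    qed
    also have "\<dots> = ennreal (\<Prod>x\<in>S - {s}. h x)
        * (\<integral>\<^sup>+f. (\<Prod>y\<in>N. if f (e s y) then ennreal (h y) else 1) \<partial>?P)"
      by (rule nn_integral_cmult) simp
    also have "(\<integral>\<^sup>+f. (\<Prod>y\<in>N. if f (e s y) then ennreal (h y) else 1) \<partial>?P)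
        = (\<Prod>y\<in>N. \<integral>\<^sup>+b. (if b then ennreal (h y) else 1) \<partial>bernoulli_pmf (q (e s y)))"
    proof (rule nn_integral_prod_Pi_pmf_inj)
      show "inj_on (e s) N"
      proof (rule inj_onI)
        fix y y' assume "y \<in> N" "y' \<in> N" "e s y = e s y'"
        then have "{s, y} = {s, y'}" by (intro inj) (auto simp: N_def)
        then show "y = y'" by (auto simp: doubleton_eq_iff)
      qed
    qed (use fin eD in \<open>auto simp: N_def\<close>)
    also have "\<dots> = (\<Prod>y\<in>N. ennreal (1 + q (e s y) * (h y - 1)))"
    proof (rule prod.cong)
      fix y assume "y \<in> N"
      then have "0 \<le> q (e s y)" "q (e s y) \<le> 1" using q[OF eD] by (auto simp: N_def)
      moreover have "0 \<le> h y" using h[of y] by linarith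
      ultimately show "(\<integral>\<^sup>+b. (if b then ennreal (h y) else 1) \<partial>bernoulli_pmf (q (e s y)))
        = ennreal (1 + q (e s y) * (h y - 1))"
        by (simp add: algebra_simps flip: ennreal_mult ennreal_1 ennreal_plus)
    qed simp
    also have "\<dots> = ennreal (\<Prod>y\<in>N. 1 + q (e s y) * (h y - 1))"
      using q[OF eD] h by (intro prod_ennreal) (auto simp: N_def)
    \<comment> \<open>All factors are at least 1, so the product may be extended to every possible
      neighbour. This is why \<open>drift\<close> need not refer to the current
      \<open>U\<close>.\<close>
    also have "(\<Prod>y\<in>N. 1 + q (e s y) * (h y - 1)) \<le> (\<Prod>y\<in>L `` {s}. 1 + q (e s y) * (h y - 1))"
      using fin q[OF eD] h by (intro prod_mono2) (auto simp: N_def finite_Image)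
    finally have "(\<integral>\<^sup>+I. F I I \<partial>?P) \<le> ennreal (\<Prod>x\<in>S - {s}. h x)
        * ennreal (\<Prod>y\<in>L `` {s}. 1 + q (e s y) * (h y - 1))"
      by (simp add: ennreal_leI mult_left_mono)
    then have "ennreal (w s) * (\<integral>\<^sup>+I. F I I \<partial>?P) \<le> ennreal (w s) * (ennreal (\<Prod>x\<in>S - {s}. h x)
        * ennreal (\<Prod>y\<in>L `` {s}. 1 + q (e s y) * (h y - 1)))"
      by (rule mult_left_mono) simp
    also have "\<dots> = ennreal ((\<Prod>x\<in>S - {s}. h x) * (w s * (\<Prod>y\<in>L `` {s}. 1 + q (e s y) * (h y - 1))))"
    proof -
      have "0 \<le> (\<Prod>y\<in>L `` {s}. 1 + q (e s y) * (h y - 1))"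
        using q[OF eD] h by (intro prod_nonneg) auto
      moreover have "0 \<le> w s" using w[of s] by linarith
      ultimately show ?thesis
        using pos by (simp add: ennreal_mult mult.left_commute)
    qed
    also have "\<dots> \<le> ennreal ((\<Prod>x\<in>S - {s}. h x) * h s)"
      using pos by (intro ennreal_leI mult_left_mono drift)
    also have "(\<Prod>x\<in>S - {s}. h x) * h s = (\<Prod>x\<in>S. h x)"
      using s less.prems by (simp add: prod.remove mult.commute)
    finally have "ennreal (w s) * (\<integral>\<^sup>+I. F I I \<partial>?P) \<le> ennreal (\<Prod>x\<in>S. h x)" .
    moreover have "(\<integral>\<^sup>+I. ennreal (\<Prod>y\<in>reach (G I) S U. w y) \<partial>?P) \<le> ennreal (w s) * (\<integral>\<^sup>+I. F I I \<partial>?P)"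
      using step by (subst nn_integral_cmult[symmetric]) (auto intro!: nn_integral_mono)
    ultimately show ?thesis by simp
  qed
qed


section \<open>Components of the random intersection graph\<close>

text \<open>Both directions of a bipartite edge are governed by the same Bernoulli variable. Pairs
  on the same side are never bipartite steps.\<close>

fun index_of :: "'v + 'a \<Rightarrow> 'v + 'a \<Rightarrow> 'v \<times> 'a" where
  "index_of (Inl v) (Inr i) = (v, i)"
| "index_of (Inr i) (Inl v) = (v, i)"
| "index_of _ _ = undefined"

definition bipartite_steps :: "('v \<times> 'a) set \<Rightarrow> (('v + 'a) \<times> ('v + 'a)) set" where
  "bipartite_steps B = (\<lambda>(v, i). (Inl v, Inr i)) ` B \<union> (\<lambda>(v, i). (Inr i, Inl v)) ` B"

lemma in_bipartite_steps [simp]: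
  "(Inl v, Inr i) \<in> bipartite_steps B \<longleftrightarrow> (v, i) \<in> B"
  "(Inr i, Inl v) \<in> bipartite_steps B \<longleftrightarrow> (v, i) \<in> B"
  "(Inl v, Inl u) \<notin> bipartite_steps B"
  "(Inr i, Inr j) \<notin> bipartite_steps B"
  by (auto simp: bipartite_steps_def)

lemma index_of_bipartite_steps: "(x, y) \<in> bipartite_steps B \<Longrightarrow> index_of x y \<in> B"
  by (cases x; cases y) auto

lemma index_of_inj:
  assumes "(x, y) \<in> bipartite_steps B" "(x', y') \<in> bipartite_steps B" "index_of x y = index_of x' y'"
  shows "{x, y} = {x', y'}"
  using assms by (cases x; cases y; cases x'; cases y') auto

text \<open>An edge of the intersection graph is a walk of length two through a shared
  attribute.\<close>

lemma rtrancl_intersection_edges: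
  assumes "(u, v) \<in> (intersection_edges V B)\<^sup>*"
  shows "(Inl u, Inl v) \<in> (bipartite_steps B)\<^sup>*"
  using assms
proof (induction rule: rtrancl_induct)
  case base
  show ?case by simp
next
  case (step v w)
  then obtain a where "(Inl v, Inr a) \<in> bipartite_steps B" "(Inr a, Inl w) \<in> bipartite_steps B"
    by (auto simp: intersection_edges_def)
  with step.IH show ?case by (meson rtrancl.rtrancl_into_rtrancl)
qed

section \<open>Exponential moments and tails of component sizes\<close>

text \<open>Since attributes have weight 1, the weight of the explored set is
  \<open>exp \<kappa>\<close> to the number of its vertices, and the exploration bound applies with
  the single active node \<open>Inl v\<close>.\<close>

lemma nn_integral_component_size:
  fixes p :: "nat \<Rightarrow> real"
  assumes p: "\<And>i. i \<in> {1..m} \<Longrightarrow> 0 \<le> p i \<and> p i \<le> 1"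
    and "0 \<le> \<kappa>" "0 \<le> \<epsilon>"
    and drift: "exp \<kappa> * (\<Prod>i=1..m. 1 + p i * ((1 + \<epsilon> * p i) ^ n - 1)) \<le> 1 + \<epsilon>"
    and v: "v \<in> {1..n}"
  shows "(\<integral>\<^sup>+I. ennreal (exp (\<kappa> * real (card {u \<in> {1..n}.
            (v, u) \<in> (intersection_edges {1..n} (bipartite_edges n m I))\<^sup>*})))
          \<partial>attribute_indicators n m p) \<le> ennreal (1 + \<epsilon>)"
proof -
  define D where "D = {1..n} \<times> {1..m}"
  define L :: "((nat + nat) \<times> (nat + nat)) set" where "L = bipartite_steps D"
  define G where "G I = {(x, y) \<in> L. I (index_of x y)}" for I :: "nat \<times> nat \<Rightarrow> bool"
  define q where "q = (\<lambda>(v :: nat, i). p i)"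
  define w :: "nat + nat \<Rightarrow> real" where "w = case_sum (\<lambda>_. exp \<kappa>) (\<lambda>_. 1)"
  \<comment> \<open>The potential of an attribute is chosen so that its drift condition is an
    equality: each of the \<open>n\<close> vertices contributes a factor
    \<open>1 + p i * \<epsilon>\<close>. Indices outside \<open>{1..m}\<close> get 1, as the drift
    must hold at every element of the type.\<close>
  define h :: "nat + nat \<Rightarrow> real" where
    "h = case_sum (\<lambda>_. 1 + \<epsilon>) (\<lambda>i. if i \<in> {1..m} then (1 + \<epsilon> * p i) ^ n else 1)"
  define V :: "(nat + nat) set" where "V = Inl ` {1..n} \<union> Inr ` {1..m}"
  have G_eq: "G I = bipartite_steps (bipartite_edges n m I)" for I
  proof -
    have "(x, y) \<in> G I \<longleftrightarrow> (x, y) \<in> bipartite_steps (bipartite_edges n m I)" for x y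
      by (cases x; cases y) (auto simp: G_def L_def D_def bipartite_edges_def)
    then show ?thesis by auto
  qed
  have finV: "finite V" by (simp add: V_def)
  have h1: "1 \<le> h x" for x
    using p \<open>0 \<le> \<epsilon>\<close> by (cases x) (auto simp: h_def intro!: one_le_power)
  have w1: "1 \<le> w x" for x
    using \<open>0 \<le> \<kappa>\<close> by (cases x) (auto simp: w_def)
  have factor: "1 \<le> 1 + p i * ((1 + \<epsilon> * p i) ^ n - 1)" if "i \<in> {1..m}" for i
    using p[OF that] \<open>0 \<le> \<epsilon>\<close> by (auto intro!: mult_nonneg_nonneg one_le_power)
  have L_drift: "w x * (\<Prod>y\<in>L `` {x}. 1 + q (index_of x y) * (h y - 1)) \<le> h x" for x
  proof (cases x)
    case (Inl u)
    show ?thesis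
    proof (cases "u \<in> {1..n}")
      case True
      have "y \<in> L `` {x} \<longleftrightarrow> y \<in> Inr ` {1..m}" for y
        using True by (cases y) (auto simp: Inl L_def D_def)
      then have "L `` {x} = Inr ` {1..m}" by blast
      then have "(\<Prod>y\<in>L `` {x}. 1 + q (index_of x y) * (h y - 1))
        = (\<Prod>i=1..m. 1 + p i * ((1 + \<epsilon> * p i) ^ n - 1))"
        by (simp add: prod.reindex Inl q_def h_def)
      with drift show ?thesis by (simp add: Inl w_def h_def)
    next
      case False
      have "y \<notin> L `` {x}" for y
        using False by (cases y) (auto simp: Inl L_def D_def)
      then have "L `` {x} = {}" by blast
      \<comment> \<open>For an isolated \<open>Inl u\<close> the drift condition is
        \<open>exp \<kappa> \<le> 1 + \<epsilon>\<close>, which follows from \<open>drift\<close>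
        because the product there is at least 1.\<close>
      moreover have "exp \<kappa> * 1 \<le> exp \<kappa> * (\<Prod>i=1..m. 1 + p i * ((1 + \<epsilon> * p i) ^ n - 1))"
        using factor by (intro mult_left_mono prod_ge_1) auto
      ultimately show ?thesis using order.trans[OF _ drift] by (simp add: Inl w_def h_def)
    qed
  next
    case (Inr i)
    show ?thesis
    proof (cases "i \<in> {1..m}")
      case True
      have "y \<in> L `` {x} \<longleftrightarrow> y \<in> Inl ` {1..n}" for y
        using True by (cases y) (auto simp: Inr L_def D_def)
      then have "L `` {x} = Inl ` {1..n}" by blast
      then have "(\<Prod>y\<in>L `` {x}. 1 + q (index_of x y) * (h y - 1)) = (1 + \<epsilon> * p i) ^ n"
        by (simp add: prod.reindex Inr q_def h_def mult.commute)
      with True show ?thesis by (simp add: Inr w_def h_def)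
    next
      case False
      have "y \<notin> L `` {x}" for y
        using False by (cases y) (auto simp: Inr L_def D_def)
      then have "L `` {x} = {}" by blast
      with False show ?thesis by (auto simp: Inr w_def h_def)
    qed
  qed
  have indicators: "attribute_indicators n m p = Pi_pmf D False (\<lambda>j. bernoulli_pmf (q j))"
    by (simp add: attribute_indicators_def D_def q_def case_prod_unfold)
  have "(\<integral>\<^sup>+I. ennreal (exp (\<kappa> * real (card {u \<in> {1..n}.
            (v, u) \<in> (intersection_edges {1..n} (bipartite_edges n m I))\<^sup>*})))
          \<partial>attribute_indicators n m p)
     \<le> (\<integral>\<^sup>+I. ennreal (\<Prod>y\<in>reach (G I) {Inl v} (V - {Inl v}). w y) \<partial>attribute_indicators n m p)"
  proof (intro nn_integral_mono ennreal_leI)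
    fix I
    let ?C = "{u \<in> {1..n}. (v, u) \<in> (intersection_edges {1..n} (bipartite_edges n m I))\<^sup>*}"
    let ?R = "reach (G I) {Inl v} (V - {Inl v})"
    have "Range (G I) \<subseteq> V"
      by (auto simp: G_def L_def D_def V_def bipartite_steps_def)
    \<comment> \<open>The component embeds in the explored set; further explored nodes have weight
      at least 1 and can only raise the product.\<close>
    then have "Inl ` ?C \<subseteq> ?R"
      using rtrancl_subset_reach[of "G I" V "Inl v"] rtrancl_intersection_edges
      by (fastforce simp: G_eq)
    moreover have "finite ?R"
      using reach_subset[of "G I" "{Inl v}" "V - {Inl v}"] finV
      by (simp add: finite_subset)
    ultimately have "(\<Prod>y\<in>Inl ` ?C. w y) \<le> (\<Prod>y\<in>?R. w y)"
      using w1 by (intro prod_mono2) (auto intro: order.trans[OF zero_le_one])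
    moreover have "(\<Prod>y\<in>Inl ` ?C. w y) = exp (\<kappa> * real (card ?C))"
      by (simp add: prod.reindex w_def mult.commute flip: exp_of_nat_mult)
    ultimately show "exp (\<kappa> * real (card ?C)) \<le> (\<Prod>y\<in>?R. w y)" by simp
  qed
  also have "(\<integral>\<^sup>+I. ennreal (\<Prod>y\<in>reach (G I) {Inl v} (V - {Inl v}). w y)
      \<partial>attribute_indicators n m p) \<le> ennreal (\<Prod>x\<in>{Inl v}. h x)"
    unfolding G_def indicators
  proof (rule exploration_weight_bound)
    show "finite D" "finite L" by (auto simp: D_def L_def bipartite_steps_def)
    show "index_of x y \<in> D" if "(x, y) \<in> L" for x y
      using that unfolding L_def by (rule index_of_bipartite_steps)
    show "{x, y} = {x', y'}"
      if "(x, y) \<in> L" "(x', y') \<in> L" "index_of x y = index_of x' y'" for x y x' y'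
      using that unfolding L_def by (rule index_of_inj)
    show "0 \<le> q j \<and> q j \<le> 1" if "j \<in> D" for j
      using that p by (auto simp: D_def q_def)
  qed (use h1 w1 L_drift finV in auto)
  also have "(\<Prod>x\<in>{Inl v}. h x) = 1 + \<epsilon>" by (simp add: h_def)
  finally show ?thesis .
qed

text \<open>Every component is the class \<open>C I v\<close> of some vertex \<open>v\<close>. Each
  \<open>C I v\<close> has an exponential tail by Markov's inequality, and the factor
  \<open>n\<close> is the union bound.\<close>

lemma prob_large_component:
  fixes p :: "nat \<Rightarrow> real"
  assumes "\<And>i. i \<in> {1..m} \<Longrightarrow> 0 \<le> p i \<and> p i \<le> 1" "0 \<le> \<kappa>" "0 \<le> \<epsilon>"
    and "exp \<kappa> * (\<Prod>i=1..m. 1 + p i * ((1 + \<epsilon> * p i) ^ n - 1)) \<le> 1 + \<epsilon>"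
  shows "measure_pmf.prob (random_intersection_graph n m p)
      {E. \<exists>K\<in>connected_components {1..n} E. b < real (card K)} \<le> real n * ((1 + \<epsilon>) * exp (- \<kappa> * b))"
proof -
  define C where "C I v = {u \<in> {1..n}.
    (v, u) \<in> (intersection_edges {1..n} (bipartite_edges n m I))\<^sup>*}" for I v
  let ?M = "attribute_indicators n m p"
  have tail: "measure_pmf.prob ?M {I. b < real (card (C I v))} \<le> (1 + \<epsilon>) * exp (- \<kappa> * b)"
    if "v \<in> {1..n}" for v
  proof -
    have "emeasure ?M {I. b < real (card (C I v))}
        \<le> emeasure ?M {I \<in> UNIV. 1 \<le> ennreal (exp (- \<kappa> * b)) * ennreal (exp (\<kappa> * real (card (C I v))))}"
    proof (rule emeasure_mono)
      show "{I. b < real (card (C I v))}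
        \<subseteq> {I \<in> UNIV. 1 \<le> ennreal (exp (- \<kappa> * b)) * ennreal (exp (\<kappa> * real (card (C I v))))}"
        using \<open>0 \<le> \<kappa>\<close> by (auto simp: mult_left_mono simp flip: ennreal_mult exp_add ennreal_1)
    qed simp
    also have "\<dots> \<le> ennreal (exp (- \<kappa> * b)) *
        (\<integral>\<^sup>+I. ennreal (exp (\<kappa> * real (card (C I v)))) * indicator UNIV I \<partial>?M)"
      by (rule nn_integral_Markov_inequality) auto
    also have "\<dots> \<le> ennreal (exp (- \<kappa> * b)) * ennreal (1 + \<epsilon>)"
      using nn_integral_component_size[OF assms that] by (intro mult_left_mono) (auto simp: C_def)
    also have "\<dots> = ennreal ((1 + \<epsilon>) * exp (- \<kappa> * b))"
      using \<open>0 \<le> \<epsilon>\<close> by (subst ennreal_mult[symmetric]) (auto simp: mult.commute)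
    finally show ?thesis
      using \<open>0 \<le> \<epsilon>\<close> by (simp add: measure_pmf.emeasure_eq_measure)
  qed
  have sub: "{I. \<exists>K\<in>connected_components {1..n} (intersection_edges {1..n} (bipartite_edges n m I)).
        b < real (card K)} \<subseteq> (\<Union>v\<in>{1..n}. {I. b < real (card (C I v))})"
  proof
    fix I assume "I \<in> {I. \<exists>K\<in>connected_components {1..n}
      (intersection_edges {1..n} (bipartite_edges n m I)). b < real (card K)}"
    then obtain v where "v \<in> {1..n}" "b < real (card ({(u, v). u \<in> {1..n} \<and> v \<in> {1..n} \<and>
        (u, v) \<in> (intersection_edges {1..n} (bipartite_edges n m I))\<^sup>*} `` {v}))"
      unfolding connected_components_def by (auto elim!: quotientE)
    moreover have "{(u, v). u \<in> {1..n} \<and> v \<in> {1..n} \<and>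
        (u, v) \<in> (intersection_edges {1..n} (bipartite_edges n m I))\<^sup>*} `` {v} = C I v"
      using \<open>v \<in> {1..n}\<close> by (auto simp: C_def)
    ultimately show "I \<in> (\<Union>v\<in>{1..n}. {I. b < real (card (C I v))})" by auto
  qed
  have "measure_pmf.prob (random_intersection_graph n m p)
      {E. \<exists>K\<in>connected_components {1..n} E. b < real (card K)}
    = measure_pmf.prob ?M {I. \<exists>K\<in>connected_components {1..n}
        (intersection_edges {1..n} (bipartite_edges n m I)). b < real (card K)}"
    by (simp add: random_intersection_graph_def measure_map_pmf vimage_def)
  also have "\<dots> \<le> measure_pmf.prob ?M (\<Union>v\<in>{1..n}. {I. b < real (card (C I v))})"
    using sub by (intro measure_pmf.finite_measure_mono) auto
  also have "\<dots> \<le> (\<Sum>v\<in>{1..n}. measure_pmf.prob ?M {I. b < real (card (C I v))})"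
    by (intro measure_pmf.finite_measure_subadditive_finite) auto
  also have "\<dots> \<le> (\<Sum>v\<in>{1..n}. (1 + \<epsilon>) * exp (- \<kappa> * b))"
    by (intro sum_mono tail)
  finally show ?thesis by simp
qed

section \<open>The drift inequality below criticality\<close>

text \<open>To first order in \<epsilon> the product is \<open>exp (\<epsilon> * c)\<close>, while
  \<open>1 + \<epsilon>\<close> is about \<open>exp \<epsilon>\<close>. The gap \<open>1 - c\<close>
  pays for \<kappa> and for all second-order errors.\<close>

lemma subcritical_drift:
  fixes p :: "nat \<Rightarrow> real"
  assumes p: "\<And>i. i \<in> {1..m} \<Longrightarrow> 0 \<le> p i" "\<And>i. i \<in> {1..m} \<Longrightarrow> \<epsilon> * (real n * p i) \<le> \<delta>"
    and c: "real n * (\<Sum>i=1..m. (p i)\<^sup>2) = c" "0 \<le> c" "c < 1"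
    and \<delta>: "\<delta> = (1 - c) / 4" and \<epsilon>: "0 \<le> \<epsilon>" "\<epsilon> \<le> \<delta>"
  shows "exp ((1 - c) / 2 * \<epsilon>) * (\<Prod>i=1..m. 1 + p i * ((1 + \<epsilon> * p i) ^ n - 1)) \<le> 1 + \<epsilon>"
proof -
  have \<delta>1: "0 \<le> \<delta>" "\<delta> \<le> 1" using \<delta> c by auto
  have factor: "1 + p i * ((1 + \<epsilon> * p i) ^ n - 1) \<le> exp (\<epsilon> * (1 + \<delta>) * (real n * (p i)\<^sup>2))"
    if i: "i \<in> {1..m}" for i
  proof -
    define x where "x = \<epsilon> * (real n * p i)"
    have x: "0 \<le> x" "x \<le> \<delta>" using p[OF i] \<epsilon> by (auto simp: x_def)
    have "(1 + \<epsilon> * p i) ^ n \<le> exp (\<epsilon> * p i) ^ n"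
      using p(1)[OF i] \<epsilon> by (intro power_mono) auto
    also have "\<dots> = exp x" by (simp add: x_def mult_ac flip: exp_of_nat_mult)
    \<comment> \<open>The bound \<open>x \<le> \<delta>\<close>, that is \<epsilon> of order at most
      \<open>1 / (n * p i)\<close>, keeps the quadratic term below
      \<open>\<delta> * x\<close>.\<close>
    also have "\<dots> \<le> 1 + x + x\<^sup>2" using x \<delta>1 by (intro exp_bound) auto
    also have "\<dots> \<le> 1 + x * (1 + \<delta>)"
      using x mult_left_mono[of x \<delta> x] by (simp add: power2_eq_square algebra_simps)
    finally have "p i * ((1 + \<epsilon> * p i) ^ n - 1) \<le> p i * (x * (1 + \<delta>))"
      using p(1)[OF i] by (intro mult_left_mono) auto
    also have "\<dots> = \<epsilon> * (1 + \<delta>) * (real n * (p i)\<^sup>2)"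
      by (simp add: x_def power2_eq_square)
    also have "1 + \<dots> \<le> exp \<dots>" by (rule exp_ge_add_one_self)
    finally show ?thesis by simp
  qed
  have "(\<Prod>i=1..m. 1 + p i * ((1 + \<epsilon> * p i) ^ n - 1))
      \<le> (\<Prod>i=1..m. exp (\<epsilon> * (1 + \<delta>) * (real n * (p i)\<^sup>2)))"
    using factor p(1) \<epsilon> by (intro prod_mono) (auto intro!: add_nonneg_nonneg mult_nonneg_nonneg one_le_power)
  also have "\<dots> = exp (\<epsilon> * (1 + \<delta>) * c)"
    by (simp add: c(1)[symmetric] sum_distrib_left flip: exp_sum)
  finally have "exp ((1 - c) / 2 * \<epsilon>) * (\<Prod>i=1..m. 1 + p i * ((1 + \<epsilon> * p i) ^ n - 1))
      \<le> exp ((1 - c) / 2 * \<epsilon> + \<epsilon> * (1 + \<delta>) * c)"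
    by (simp add: exp_add)
  \<comment> \<open>The gap \<open>1 - c = 4 * \<delta>\<close> is shared out:
    \<open>2 * \<delta>\<close> for \<kappa>, \<open>\<delta>\<close> for the error
    \<open>\<delta> * c\<close>, and the last \<open>\<delta> \<ge> \<epsilon>\<close> for the loss
    in \<open>ln (1 + \<epsilon>) \<ge> \<epsilon> - \<epsilon>\<^sup>2\<close>.\<close>
  also have "(1 - c) / 2 * \<epsilon> + \<epsilon> * (1 + \<delta>) * c \<le> \<epsilon> - \<epsilon>\<^sup>2"
  proof -
    have "\<delta> * c \<le> \<delta>" using \<delta>1 c by (simp add: mult_left_le)
    moreover have "(1 + \<delta>) * c = c + \<delta> * c" by (simp add: distrib_right)
    moreover have "(1 - c) / 2 = 2 * \<delta>" "c = 1 - 4 * \<delta>" using \<delta> by simp_all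
    ultimately have "(1 - c) / 2 + (1 + \<delta>) * c \<le> 1 - \<epsilon>" using \<epsilon>(2) by linarith
    then have "\<epsilon> * ((1 - c) / 2 + (1 + \<delta>) * c) \<le> \<epsilon> * (1 - \<epsilon>)" using \<epsilon> by (intro mult_left_mono)
    then show ?thesis by (simp add: algebra_simps power2_eq_square)
  qed
  also have "\<epsilon> - \<epsilon>\<^sup>2 \<le> ln (1 + \<epsilon>)"
    using \<epsilon> \<delta>1 by (intro ln_one_plus_pos_lower_bound) auto
  also have "exp (ln (1 + \<epsilon>)) = 1 + \<epsilon>" using \<epsilon> by simp
  finally show ?thesis by simp
qed

section \<open>Choice of parameters and the limit\<close>

theorem theorem1:
  fixes c :: real
  assumes "c < 1"
  shows "\<exists>C>0. \<forall>(m :: nat \<Rightarrow> nat) (p :: nat \<Rightarrow> nat \<Rightarrow> real).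
    (\<forall>n\<ge>1. m n \<ge> 1 \<and> (\<forall>i\<in>{1..m n}. 0 \<le> p n i \<and> p n i \<le> 1) \<and>
       real n * (\<Sum>i=1..m n. (p n i)\<^sup>2) = c) \<longrightarrow>
    (\<lambda>n. measure_pmf.prob (random_intersection_graph n (m n) (p n))
       {E. \<forall>K\<in>connected_components {1..n} E.
          real (card K) \<le> C * max (real n * Max (p n ` {1..m n}) * ln (real n)) (ln (real n))})
      \<longlonglongrightarrow> 1"
proof -
  \<comment> \<open>Chosen to give \<open>\<kappa> * b n = 2 * ln n\<close> below: \<kappa> is
    \<open>(1 - c)\<^sup>2 / (8 * M)\<close> and \<open>b n\<close> is \<open>C * M * ln n\<close>.
    Each vertex then has tail of order \<open>1 / n\<^sup>2\<close>, which survives the union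
    bound.\<close>
  define C where "C = 16 / (1 - c)\<^sup>2"
  have "C > 0" using assms by (simp add: C_def)
  have "(\<lambda>n. measure_pmf.prob (random_intersection_graph n (m n) (p n))
       {E. \<forall>K\<in>connected_components {1..n} E.
          real (card K) \<le> C * max (real n * Max (p n ` {1..m n}) * ln (real n)) (ln (real n))})
      \<longlonglongrightarrow> 1"
    if H: "\<forall>n\<ge>1. m n \<ge> 1 \<and> (\<forall>i\<in>{1..m n}. 0 \<le> p n i \<and> p n i \<le> 1) \<and>
       real n * (\<Sum>i=1..m n. (p n i)\<^sup>2) = c" for m :: "nat \<Rightarrow> nat" and p :: "nat \<Rightarrow> nat \<Rightarrow> real"
  proof -
    define b where "b n = C * max (real n * Max (p n ` {1..m n}) * ln (real n)) (ln (real n))" for n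
    define Q where "Q n = measure_pmf.prob (random_intersection_graph n (m n) (p n))
       {E. \<forall>K\<in>connected_components {1..n} E. real (card K) \<le> b n}" for n
    \<comment> \<open>The case \<open>n = 1\<close> exhibits \<open>c\<close> as a sum of squares,
      hence nonnegative.\<close>
    have "real 1 * (\<Sum>i=1..m 1. (p 1 i)\<^sup>2) = c" using H by blast
    moreover have "0 \<le> (\<Sum>i=1..m 1. (p 1 i)\<^sup>2)" by (intro sum_nonneg) simp
    ultimately have "0 \<le> c" by simp
    have lower: "1 - 2 / real n \<le> Q n" if "n \<ge> 1" for n
    proof -
      define \<delta> where "\<delta> = (1 - c) / 4"
      define P where "P = Max (p n ` {1..m n})"
      \<comment> \<open>The 1 in the maximum ensures \<open>\<epsilon> \<le> \<delta>\<close>, and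
        the other entry ensures \<open>\<epsilon> * (n * p i) \<le> \<delta>\<close>. It also
        matches the two terms of the claimed size, which is \<open>M * ln n\<close> up to the
        constant.\<close>
      define M where "M = max (real n * P) 1"
      define \<epsilon> where "\<epsilon> = \<delta> / M"
      define \<kappa> where "\<kappa> = (1 - c) / 2 * \<epsilon>"
      have p: "0 \<le> p n i \<and> p n i \<le> 1" if "i \<in> {1..m n}" for i
        using H \<open>n \<ge> 1\<close> that by blast
      have "M \<ge> 1" "0 < \<delta>" "\<delta> \<le> 1"
        using assms \<open>0 \<le> c\<close> by (auto simp: M_def \<delta>_def)
      then have \<epsilon>: "0 \<le> \<epsilon>" "\<epsilon> \<le> \<delta>" "\<epsilon> * M = \<delta>"
        by (auto simp: \<epsilon>_def divide_le_eq mult_le_cancel_left1)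
      have "0 \<le> \<kappa>" using assms \<epsilon> by (simp add: \<kappa>_def)
      have "\<epsilon> * (real n * p n i) \<le> \<delta>" if "i \<in> {1..m n}" for i
      proof -
        have "real n * p n i \<le> real n * P"
          unfolding P_def using that by (intro mult_left_mono Max_ge) auto
        then have "real n * p n i \<le> M" by (simp add: M_def)
        then have "\<epsilon> * (real n * p n i) \<le> \<epsilon> * M" using \<epsilon>(1) by (rule mult_left_mono)
        with \<epsilon>(3) show ?thesis by simp
      qed
      then have drift: "exp \<kappa> * (\<Prod>i=1..m n. 1 + p n i * ((1 + \<epsilon> * p n i) ^ n - 1)) \<le> 1 + \<epsilon>"
        unfolding \<kappa>_def
        using p H \<open>n \<ge> 1\<close> \<open>0 \<le> c\<close> assms \<epsilon> by (intro subcritical_drift[OF _ _ _ _ _ \<delta>_def]) auto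
      \<comment> \<open>Nonnegativity of the logarithm allows it to be factored out of the maximum
        in \<open>b n\<close>.\<close>
      have "0 \<le> ln (real n)" using \<open>n \<ge> 1\<close> by simp
      then have "b n = C * (M * ln (real n))"
        by (simp add: b_def M_def P_def max_mult_distrib_right)
      then have "\<kappa> * b n = ((1 - c) / 2 * C * (\<epsilon> * M)) * ln (real n)"
        by (simp add: \<kappa>_def)
      also have "(1 - c) / 2 * C * (\<epsilon> * M) = 2"
        using assms by (simp add: \<epsilon>(3) C_def \<delta>_def power2_eq_square nonzero_divide_eq_eq)
      finally have "exp (- \<kappa> * b n) = 1 / (real n)\<^sup>2"
        using \<open>n \<ge> 1\<close> by (simp add: exp_minus exp_double divide_inverse)
      then have "real n * ((1 + \<epsilon>) * exp (- \<kappa> * b n)) = (1 + \<epsilon>) / real n"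
        using \<open>n \<ge> 1\<close> by (simp add: power2_eq_square)
      also have "\<dots> \<le> 2 / real n"
        using \<epsilon> \<open>\<delta> \<le> 1\<close> by (intro divide_right_mono) auto
      finally have "measure_pmf.prob (random_intersection_graph n (m n) (p n))
          {E. \<exists>K\<in>connected_components {1..n} E. b n < real (card K)} \<le> 2 / real n"
        using prob_large_component[OF p \<open>0 \<le> \<kappa>\<close> \<epsilon>(1) drift, of "b n"] by simp
      moreover have "{E. \<exists>K\<in>connected_components {1..n} E. b n < real (card K)}
          = space (random_intersection_graph n (m n) (p n))
            - {E. \<forall>K\<in>connected_components {1..n} E. real (card K) \<le> b n}"
        by (auto simp: not_le)
      ultimately show ?thesis
        using measure_pmf.prob_compl[of "{E. \<forall>K\<in>connected_components {1..n} E. real (card K) \<le> b n}"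
            "random_intersection_graph n (m n) (p n)"] unfolding Q_def by simp
    qed
    have "Q \<longlonglongrightarrow> 1"
    proof (rule tendsto_sandwich)
      show "\<forall>\<^sub>F n in sequentially. 1 - 2 / real n \<le> Q n"
        using lower by (auto simp: eventually_sequentially)
      show "\<forall>\<^sub>F n in sequentially. Q n \<le> 1" by (simp add: Q_def)
      show "(\<lambda>n. 1 - 2 / real n) \<longlonglongrightarrow> 1"
        using tendsto_diff[OF tendsto_const[of 1] lim_const_over_n[of "2 :: real"]] by simp
    qed simp
    then show ?thesis unfolding Q_def b_def .
  qed
  with \<open>C > 0\<close> show ?thesis by blast
qed

end
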